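(* For all integers $l>k\ge 2$, $$\operatorname{ex}\!\left(n,C_{2k+1},\mathscr{C}_{2k}\cup\{C_{2l+1}\}\right)=O_{k,l}\!\left(n^{\,2-\frac{1}{k(k+1)(l-k)}}\right),$$ that is, for all integers $l>k\ge 2$ there is a constant $K=K(k,l)>0$ such that for every $n\ge 1$, every $n$-vertex graph that contains no cycle of length $3,4,\ldots,2k$ and no cycle of length $2l+1$ as a subgraph contains at most $K\,n^{2-\frac{1}{k(k+1)(l-k)}}$ copies of $C_{2k+1}$.
   Context: All graphs are finite and simple. $C_i$ denotes the cycle of length $i$ ($i\ge 3$), and $\mathscr{C}_r=\{C_3,C_4,\ldots,C_r\}$ for $r\ge 3$. For a family $\mathcal F$ of graphs, a graph is $\mathcal F$-free if it contains no member of $\mathcal F$ as a (not necessarily induced) subgraph. For graphs $H$ and $G$, $N(H,G)$ is the number of copies of $H$ in $G$, counted as unlabeled, not necessarily induced subgraphs. The generalized Turán number is $\operatorname{ex}(n,H,\mathcal F)=\max\{N(H,G): |V(G)|=n \text{ and } G \text{ is } \mathcal F\text{-free}\}$. The notation $O_{k,l}(\cdot)$ means that the implied constant depends only on $k$ and $l$. *)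

theory Defs
  imports Complex_Main "Graph_Theory.Pair_Digraph" "Graph_Theory.Digraph_Isomorphism"
begin

text \<open>
  Finite simple graphs are rendered as \<^locale>\<open>pair_graph\<close>: finite, loop-free digraphs
  without parallel arcs whose arc relation is symmetric, so that an undirected edge
  \<open>uv\<close> is the pair of arcs \<open>(u, v)\<close>, \<open>(v, u)\<close>.
\<close>

text \<open>The cycle of length \<open>i\<close> on \<open>{0, \<dots>, i - 1}\<close>; meaningful only for \<open>i \<ge> 3\<close>.\<close>

definition cycle_graph :: "nat \<Rightarrow> nat pair_pre_digraph" where
  "cycle_graph i = \<lparr> pverts = {0..<i},
     parcs = {(u, v). u < i \<and> v < i \<and> (v = Suc u mod i \<or> u = Suc v mod i)} \<rparr>"

definition cycles_upto :: "nat \<Rightarrow> nat pair_pre_digraph set" where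
  "cycles_upto r = cycle_graph ` {3..r}"

text \<open>
  The copies of \<open>H\<close> in \<open>G\<close> are the (not necessarily induced) subgraphs of \<open>G\<close> isomorphic
  to \<open>H\<close>; they are counted as subgraphs, not as embeddings.
\<close>

definition copies :: "'b pair_pre_digraph \<Rightarrow> 'a pair_pre_digraph \<Rightarrow> 'a pair_pre_digraph set" where
  "copies H G = {K. pair_graph K \<and> subgraph (with_proj K) (with_proj G) \<and>
     digraph_iso (with_proj H) (with_proj K)}"

definition num_copies :: "'b pair_pre_digraph \<Rightarrow> 'a pair_pre_digraph \<Rightarrow> nat" where
  "num_copies H G = card (copies H G)"

definition family_free :: "'b pair_pre_digraph set \<Rightarrow> 'a pair_pre_digraph \<Rightarrow> bool" where
  "family_free \<F> G \<longleftrightarrow> (\<forall>H\<in>\<F>. copies H G = {})"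

text \<open>
  The vertices of the host graphs are taken from \<^typ>\<open>nat\<close>. By \<open>num_copies_le_gen_turan\<close>
  below this is no restriction; by \<open>finite_turan_values\<close> the maximum ranges over a finite set.
\<close>

definition gen_turan :: "nat \<Rightarrow> 'b pair_pre_digraph \<Rightarrow> 'c pair_pre_digraph set \<Rightarrow> nat" where
  "gen_turan n H \<F> = Max {num_copies H G |G :: nat pair_pre_digraph.
     pair_graph G \<and> card (pverts G) = n \<and> family_free \<F> G}"

lemma pair_graph_cycle_graph:
  assumes "i \<ge> 3"
  shows "pair_graph (cycle_graph i)"
proof
  show "finite (parcs (cycle_graph i))"
    by (rule finite_subset[of _ "{0..<i} \<times> {0..<i}"]) (auto simp: cycle_graph_def)
  show "symmetric (with_proj (cycle_graph i))"
    by (auto simp: symmetric_def sym_def cycle_graph_def)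
  fix e assume "e \<in> parcs (cycle_graph i)"
  moreover have "Suc u mod i \<noteq> u" if "u < i" for u
    using that assms by (cases "Suc u = i") auto
  ultimately show "fst e \<noteq> snd e" 
    by (auto simp: cycle_graph_def) metis+
qed (auto simp: cycle_graph_def)

lemma copies_subset:
  "(\<lambda>K. (pverts K, parcs K)) ` copies H G \<subseteq> Pow (pverts G) \<times> Pow (parcs G)"
  by (auto simp: copies_def subgraph_def)

lemma inj_pverts_parcs: "inj_on (\<lambda>K :: 'a pair_pre_digraph. (pverts K, parcs K)) A"
  by (auto intro!: inj_onI pair_pre_digraph.equality)

lemma finite_copies:
  assumes "pair_graph G"
  shows "finite (copies H G)"
proof -
  interpret pair_graph G by fact
  show ?thesis
    by (rule finite_imageD[OF finite_subset[OF copies_subset] inj_pverts_parcs])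
      (auto simp: pair_finite_verts pair_finite_arcs)
qed

lemma num_copies_le:
  assumes "pair_graph G"
  shows "num_copies H G \<le> 2 ^ card (pverts G) * 2 ^ (card (pverts G))\<^sup>2"
proof -
  interpret pair_graph G by fact
  have "parcs G \<subseteq> pverts G \<times> pverts G"
    by (auto dest: in_arcsD1 in_arcsD2)
  then have "card (parcs G) \<le> (card (pverts G))\<^sup>2"
    using card_mono[of "pverts G \<times> pverts G" "parcs G"] pair_finite_verts
    by (simp add: card_cartesian_product power2_eq_square)
  moreover have "num_copies H G \<le> card (Pow (pverts G) \<times> Pow (parcs G))"
    unfolding num_copies_def card_image[OF inj_pverts_parcs[of "copies H G"], symmetric]
    by (rule card_mono[OF _ copies_subset]) (auto simp: pair_finite_verts pair_finite_arcs)
  ultimately show ?thesis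
    using pair_finite_verts pair_finite_arcs
    by (auto simp: card_cartesian_product card_Pow elim!: order_trans)
qed

lemma finite_turan_values:
  "finite {num_copies H G |G. pair_graph G \<and> card (pverts G) = n \<and> family_free \<F> G}"
  by (rule finite_subset[of _ "{..2 ^ n * 2 ^ n\<^sup>2}"]) (auto dest: num_copies_le)

definition relabel :: "('a \<Rightarrow> 'b) \<Rightarrow> 'a pair_pre_digraph \<Rightarrow> 'b pair_pre_digraph" where
  "relabel f G = \<lparr> pverts = f ` pverts G, parcs = map_prod f f ` parcs G \<rparr>"

lemma pair_graph_relabel:
  assumes "pair_graph G" "inj_on f (pverts G)"
  shows "pair_graph (relabel f G)"
proof -
  interpret pair_graph G by fact
  show ?thesis
  proof
    show "symmetric (with_proj (relabel f G))"
      using pair_sym_arcs by (force simp: symmetric_def sym_def relabel_def)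
    fix e assume "e \<in> parcs (relabel f G)"
    then obtain u v where "e = (f u, f v)" "(u, v) \<in> parcs G"
      by (auto simp: relabel_def)
    then show "fst e \<noteq> snd e"
      using assms(2) pair_no_loops[of "(u, v)"] in_arcsD1[of u v] in_arcsD2[of u v]
      by (auto dest: inj_onD)
  qed (auto simp: relabel_def pair_finite_verts pair_finite_arcs dest: in_arcsD1 in_arcsD2)
qed

lemma digraph_iso_relabel:
  assumes "pair_graph G" "inj_on f (pverts G)"
  shows "digraph_iso (with_proj G) (with_proj (relabel f G))"
proof -
  interpret pair_graph G by fact
  have "parcs G \<subseteq> pverts G \<times> pverts G"
    by (auto dest: in_arcsD1 in_arcsD2)
  then have "inj_on (map_prod f f) (parcs G)"
    using map_prod_inj_on[OF assms(2) assms(2)] inj_on_subset by blast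
  then show ?thesis
    unfolding digraph_iso_def pre_digraph.digraph_isomorphism_def
    by (intro exI[of _ "\<lparr> iso_verts = f, iso_arcs = map_prod f f, iso_head = snd, iso_tail = fst \<rparr>"])
      (auto simp: app_iso_def with_proj_def relabel_def assms(2) wf_digraph_wp_iff[unfolded with_proj_def]
        intro: pair_wf_digraph)
qed

lemma subgraph_with_proj_iff:
  assumes "pair_graph K" "pair_graph G"
  shows "subgraph (with_proj K) (with_proj G) \<longleftrightarrow> pverts K \<subseteq> pverts G \<and> parcs K \<subseteq> parcs G"
proof -
  interpret K: pair_graph K by fact
  interpret G: pair_graph G by fact
  show ?thesis
    by (auto simp: subgraph_def compatible_def wf_digraph_wp_iff
        intro: K.pair_wf_digraph G.pair_wf_digraph)
qed

lemma relabel_in_copies: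
  assumes "pair_graph G" "inj_on f (pverts G)" "K \<in> copies H G"
  shows "relabel f K \<in> copies H (relabel f G)"
proof -
  have K: "pair_graph K" "pverts K \<subseteq> pverts G" "parcs K \<subseteq> parcs G"
    and iso: "digraph_iso (with_proj H) (with_proj K)"
    using assms(1,3) by (auto simp: copies_def subgraph_with_proj_iff)
  have inj: "inj_on f (pverts K)"
    using assms(2) K(2) by (rule inj_on_subset)
  have "pverts (relabel f K) \<subseteq> pverts (relabel f G)" "parcs (relabel f K) \<subseteq> parcs (relabel f G)"
    using K by (auto simp: relabel_def)
  then show ?thesis
    using pair_graph_relabel[OF K(1) inj] pair_graph_relabel[OF assms(1,2)]
      digraph_iso_trans[OF iso digraph_iso_relabel[OF K(1) inj]]
    by (simp add: copies_def subgraph_with_proj_iff)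
qed

lemma relabel_inverse:
  assumes "pair_graph G" "\<And>x. x \<in> pverts G \<Longrightarrow> g (f x) = x"
  shows "relabel g (relabel f G) = G"
proof -
  interpret pair_graph G by fact
  have "map_prod g g (map_prod f f e) = e" if "e \<in> parcs G" for e
    using that assms(2) by (cases e) (auto dest: in_arcsD1 in_arcsD2)
  then show ?thesis
    using assms(2) by (intro pair_pre_digraph.equality) (auto simp: relabel_def image_image)
qed

lemma copies_relabel:
  assumes "pair_graph G" "inj_on f (pverts G)"
  shows "copies H (relabel f G) = relabel f ` copies H G" and "inj_on (relabel f) (copies H G)"
proof -
  define g where "g = the_inv_into (pverts G) f"
  have gf: "g (f x) = x" if "x \<in> pverts G" for x
    using that assms(2) by (simp add: g_def the_inv_into_f_f)
  have fg: "f (g y) = y" if "y \<in> pverts (relabel f G)" for y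
    using that gf by (auto simp: relabel_def)
  have inj: "inj_on g (pverts (relabel f G))"
    using fg by (rule inj_on_inverseI)
  have G': "pair_graph (relabel f G)"
    using assms by (rule pair_graph_relabel)
  have sub: "pair_graph K \<and> pverts K \<subseteq> pverts L" if "K \<in> copies H L" for K and L :: "'z pair_pre_digraph"
    using that by (auto simp: copies_def subgraph_def)
  have gfK: "relabel g (relabel f K) = K" if "K \<in> copies H G" for K
    using sub[OF that] gf by (intro relabel_inverse) auto
  then show "inj_on (relabel f) (copies H G)"
    by (rule inj_on_inverseI)
  show "copies H (relabel f G) = relabel f ` copies H G"
  proof (intro equalityI subsetI)
    fix K assume K: "K \<in> copies H (relabel f G)"
    then have "relabel g K \<in> copies H G"
      using relabel_in_copies[OF G' inj K] relabel_inverse[of G g f] assms(1) gf by simp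
    moreover have "relabel f (relabel g K) = K"
      using sub K fg by (intro relabel_inverse) blast+
    ultimately show "K \<in> relabel f ` copies H G"
      by (metis imageI)
  qed (auto intro: relabel_in_copies assms)
qed

lemma num_copies_le_gen_turan:
  fixes G :: "'a pair_pre_digraph"
  assumes "pair_graph G" "family_free \<F> G"
  shows "num_copies H G \<le> gen_turan (card (pverts G)) H \<F>"
proof -
  interpret pair_graph G by fact
  obtain f :: "'a \<Rightarrow> nat" where f: "inj_on f (pverts G)"
    using finite_imp_inj_to_nat_seg[OF pair_finite_verts] by auto
  have "num_copies H (relabel f G) = num_copies H G"
    using copies_relabel[OF assms(1) f, of H] by (simp add: num_copies_def card_image)
  moreover have "card (pverts (relabel f G)) = card (pverts G)"
    using f by (simp add: relabel_def card_image)
  moreover have "family_free \<F> (relabel f G)"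
    using assms(2) by (simp add: family_free_def copies_relabel(1)[OF assms(1) f])
  ultimately show ?thesis
    unfolding gen_turan_def using pair_graph_relabel[OF assms(1) f]
    by (intro Max_ge finite_turan_values) (auto intro!: exI[of _ "relabel f G"])
qed

end

theory Submission
  imports Defs "HOL-Library.FuncSet"
begin

text \<open>
  Let \<open>G\<close> have \<open>n\<close> vertices, girth at least \<open>2 k + 1\<close> and no cycle of length \<open>2 l + 1\<close>, and put
  \<open>m = l - k\<close>. Call \<open>z\<close> an antipode of \<open>w\<close> if some \<open>(2 k + 1)\<close>-cycle contains both, at the distance
  \<open>k\<close> along the cycle. Three observations give the bound \<open>O(n powr (2 - 1 / (2 k + 1)))\<close> for the
  number \<open>N\<close> of \<open>(2 k + 1)\<close>-cycles, and \<open>2 k + 1 \<le> k (k + 1) (l - k)\<close>.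

  First, the degrees of the antipodes of a vertex \<open>w\<close> sum to \<open>O(n)\<close>. Otherwise the edges at the
  antipodes contain a path of length \<open>2 m\<close> between two antipodes \<open>u\<close> and \<open>z\<close>. Going
  from \<open>w\<close> to \<open>u\<close> the long way round a \<open>(2 k + 1)\<close>-cycle, along the path to \<open>z\<close>, and back to \<open>w\<close>
  the short way round another \<open>(2 k + 1)\<close>-cycle gives a closed walk of length
  \<open>(k + 1) + 2 m + k = 2 l + 1\<close>. It is a cycle if the pieces are disjoint, and a random colouring of
  the vertices, with one colour for each role, achieves this at the price of a constant factor
  (\<open>antipode_degree_sum\<close>). The same argument inside the set of antipodes shows that it spans
  linearly many edges. By the girth condition, a cycle through \<open>w\<close> is determined by its opposite
  edge; so the number of cycles through \<open>w\<close> is at most a constant times the number of antipodes of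
  \<open>w\<close> (\<open>cycles_through_vertex\<close>).

  Second, being antipodes is a symmetric relation. If a typical vertex has \<open>N / n\<close> antipodes, then
  summing the first observation over all \<open>w\<close> shows that the graph has only \<open>O(n ^ 3 / N)\<close> edges,
  so a typical edge lies on many cycles. As each vertex lies on \<open>O(n)\<close> cycles, the edges that lie on
  many cycles form a graph of maximum degree \<open>D = O(n ^ 4 / N ^ 2)\<close>.

  Third, in a graph of maximum degree \<open>D\<close> a vertex has at most \<open>D ^ k\<close> antipodes, hence
  \<open>N = O(n * D ^ k)\<close>. Solving for \<open>N\<close> gives the bound (\<open>odd_cycle_bound\<close>).
\<close>

section \<open>Paths and cycles as lists of vertices\<close>

definition simple_path :: "('a \<times> 'a) set \<Rightarrow> 'a list \<Rightarrow> bool" where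
  "simple_path E p \<longleftrightarrow> distinct p \<and> successively (\<lambda>x y. (x, y) \<in> E) p"

text \<open>
  A cycle is written as the list of its vertices, so every cycle of length \<open>r \<ge> 3\<close> has \<open>2 r\<close>
  names: a starting point and a direction. Counting the names costs only a constant factor.
  A list of length two that traverses an edge back and forth also satisfies the predicate, whence
  the assumptions \<open>3 \<le> length p\<close> below.
\<close>

definition simple_cycle :: "('a \<times> 'a) set \<Rightarrow> 'a list \<Rightarrow> bool" where
  "simple_cycle E p \<longleftrightarrow> p \<noteq> [] \<and> simple_path E p \<and> (last p, hd p) \<in> E"

definition cycles :: "nat \<Rightarrow> ('a \<times> 'a) set \<Rightarrow> 'a list set" where
  "cycles r E = {p. length p = r \<and> simple_cycle E p}"

text \<open>
  On a cycle of length \<open>2 k + 1\<close> through \<open>w\<close>, the two ends of the edge opposite \<open>w\<close> are its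
  antipodes: \<open>as\<close> is the interior of the short arc from \<open>w\<close> to \<open>z\<close>, of length \<open>k\<close>, and \<open>bs\<close> is
  the interior of the long arc back to \<open>w\<close>.
\<close>

definition antipodes :: "nat \<Rightarrow> ('a \<times> 'a) set \<Rightarrow> 'a \<Rightarrow> 'a set" where
  "antipodes k E w = {z. \<exists>as bs. length as = k - 1 \<and> length bs = k \<and> simple_cycle E (w # as @ z # bs)}"

lemma successively_sym_rev:
  assumes "sym E"
  shows "successively (\<lambda>x y. (x, y) \<in> E) (rev p) \<longleftrightarrow> successively (\<lambda>x y. (x, y) \<in> E) p"
proof -
  have "(\<lambda>x y. (y, x) \<in> E) = (\<lambda>x y. (x, y) \<in> E)"
    using assms by (auto intro!: ext dest: symD)
  then show ?thesis unfolding successively_rev by (rule arg_cong)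
qed

lemma simple_cycle_swap:
  assumes "simple_cycle E (xs @ ys)"
  shows "simple_cycle E (ys @ xs)"
  using assms
  by (cases "xs = []"; cases "ys = []")
    (auto simp: simple_cycle_def simple_path_def successively_append_iff)

lemma simple_cycle_rev:
  assumes "sym E" "simple_cycle E p"
  shows "simple_cycle E (rev p)"
  using assms
  by (auto simp: simple_cycle_def simple_path_def successively_sym_rev hd_rev last_rev
      simp del: successively_rev dest: symD)

lemma simple_cycle_reverse_tail:
  assumes "sym E" "simple_cycle E (w # xs)"
  shows "simple_cycle E (w # rev xs)"
  using simple_cycle_swap[of E "rev xs" "[w]"] simple_cycle_rev[OF assms] by simp

lemma simple_cycle_mono: "simple_cycle E p \<Longrightarrow> E \<subseteq> F \<Longrightarrow> simple_cycle F p"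
  unfolding simple_cycle_def simple_path_def by (auto elim!: successively_mono)

lemma simple_cycle_conv_nth:
  "simple_cycle E p \<longleftrightarrow> p \<noteq> [] \<and> distinct p \<and> (\<forall>i<length p. (p ! i, p ! (Suc i mod length p)) \<in> E)"
proof (cases "p = []")
  case False
  have "(\<forall>i<length p. (p ! i, p ! (Suc i mod length p)) \<in> E)
     \<longleftrightarrow> (\<forall>i. Suc i < length p \<longrightarrow> (p ! i, p ! Suc i) \<in> E) \<and> (last p, hd p) \<in> E" (is "?l = ?r")
  proof
    assume l: ?l
    have "(p ! (length p - 1), p ! (Suc (length p - 1) mod length p)) \<in> E"
      using l False by (metis Suc_pred' length_greater_0_conv lessI)
    moreover have "(p ! i, p ! Suc i) \<in> E" if "Suc i < length p" for i
      using l[rule_format, of i] that by simp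
    ultimately show ?r using False by (simp add: last_conv_nth hd_conv_nth)
  next
    assume r: ?r
    show ?l
    proof (intro allI impI)
      fix i assume "i < length p"
      then consider "Suc i < length p" | "Suc i = length p" by linarith
      then show "(p ! i, p ! (Suc i mod length p)) \<in> E"
      proof cases
        case 2
        then have "i = length p - 1" by simp
        then show ?thesis using r 2 False by (simp add: last_conv_nth hd_conv_nth)
      qed (use r in auto)
    qed
  qed
  then show ?thesis
    using False by (auto simp: simple_cycle_def simple_path_def successively_conv_nth)
qed (simp add: simple_cycle_def)

lemma simple_cycle_subset_Domain:
  assumes "simple_cycle E p"
  shows "set p \<subseteq> Domain E"
  using assms by (fastforce simp: simple_cycle_conv_nth in_set_conv_nth)

lemma finite_cycles:
  assumes "finite V" "E \<subseteq> V \<times> V"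
  shows "finite (cycles r E)"
proof (rule finite_subset)
  show "cycles r E \<subseteq> {p. set p \<subseteq> V \<and> length p = r}"
    using assms(2) simple_cycle_subset_Domain by (fastforce simp: cycles_def)
qed (use assms finite_lists_length_eq in auto)

text \<open>
  Drop the common initial segment; then follow \<open>p\<close> until it first meets \<open>q\<close> again and return
  along \<open>q\<close>. This is what the girth condition is used for: two vertices are joined by at most
  one path of length \<open>k\<close> if there is no cycle of length between \<open>3\<close> and \<open>2 k\<close>.
\<close>

lemma cycle_from_two_paths:
  assumes "sym E" "simple_path E p" "simple_path E q" "p \<noteq> []" "q \<noteq> []"
    and "hd p = hd q" "last p = last q" "p \<noteq> q"
  shows "\<exists>c. simple_cycle E c \<and> 3 \<le> length c \<and> length c + 2 \<le> length p + length q"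
  using assms(2-)
proof (induction p arbitrary: q)
  case (Cons x p)
  from Cons.prems obtain q' where q: "q = x # q'" by (cases q) auto
  have ne: "p \<noteq> []" "q' \<noteq> []"
    using Cons.prems q by (auto simp: simple_path_def split: if_splits)
  have paths: "simple_path E p" "simple_path E q'"
    using Cons.prems q by (auto simp: simple_path_def successively_Cons)
  show ?case
  proof (cases "hd p = hd q'")
    case True
    from Cons.IH[OF paths(1,2) ne True] show ?thesis
      using Cons.prems q ne by force
  next
    case False
    have "\<exists>y\<in>set p. y \<in> set q'"
      using Cons.prems(6) ne q by (metis last_ConsR last_in_set)
    from split_list_first_prop[OF this] obtain u y v
      where p: "p = u @ y # v" and y: "y \<in> set q'" and u: "\<forall>z\<in>set u. z \<notin> set q'" by blast
    from y obtain u' v' where q': "q' = u' @ y # v'" by (meson split_list)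
    define c where "c = x # u @ y # rev u'"
    have p_path: "distinct (u @ y # v)" "successively (\<lambda>x y. (x, y) \<in> E) ((x # u @ [y]) @ v)"
      using Cons.prems(1) p by (auto simp: simple_path_def)
    have q_path: "distinct (x # u' @ y # v')" "successively (\<lambda>x y. (x, y) \<in> E) ((x # u' @ [y]) @ v')"
      using Cons.prems(2) q q' by (auto simp: simple_path_def)
    have "successively (\<lambda>x y. (x, y) \<in> E) (x # u @ [y])" "successively (\<lambda>x y. (x, y) \<in> E) (x # u' @ [y])"
      using p_path(2) q_path(2) unfolding successively_append_iff by blast+
    moreover from this(2) \<open>sym E\<close> have "successively (\<lambda>x y. (x, y) \<in> E) (rev (x # u' @ [y]))"
      using successively_sym_rev by blast
    ultimately have "successively (\<lambda>x y. (x, y) \<in> E) c" "(last c, hd c) \<in> E"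
      unfolding c_def by (auto simp: successively_append_iff successively_Cons last_rev hd_append
          simp del: successively_rev split: if_splits)
    moreover have "x \<notin> set u"
      using Cons.prems(1) p by (auto simp: simple_path_def)
    then have "distinct c"
      using p_path(1) q_path(1) u q' unfolding c_def by auto
    ultimately have "simple_cycle E c"
      by (auto simp: simple_cycle_def simple_path_def c_def)
    moreover have "u \<noteq> [] \<or> u' \<noteq> []"
      using False p q' by auto
    then have "3 \<le> length c"
      unfolding c_def by (cases u; cases u') auto
    ultimately show ?thesis
      unfolding q p q' c_def by (intro exI[of _ "x # u @ y # rev u'"]) auto
  qed
qed simp

section \<open>Paths in dense graphs, and colour coding\<close>

text \<open>
  Delete vertices of degree at most \<open>d\<close> one at a time: each deletion destroys at most \<open>2 d\<close> arcs,
  so the process stops before all vertices are gone.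
\<close>

lemma dense_subset:
  fixes H :: "('a \<times> 'a) set"
  assumes "sym H" "finite U" "2 * d * card U < card (H \<inter> U \<times> U)"
  shows "\<exists>W\<subseteq>U. W \<noteq> {} \<and> (\<forall>u\<in>W. d < card {v \<in> W. (u, v) \<in> H})"
  using assms(2,3)
proof (induction "card U" arbitrary: U rule: less_induct)
  case less
  show ?case
  proof (cases "\<forall>u\<in>U. d < card {v \<in> U. (u, v) \<in> H}")
    case True
    moreover have "U \<noteq> {}" using less.prems by auto
    ultimately show ?thesis by blast
  next
    case False
    then obtain u where u: "u \<in> U" "card {v \<in> U. (u, v) \<in> H} \<le> d" by force
    let ?N = "{v \<in> U. (u, v) \<in> H}" and ?U = "U - {u}"
    have "H \<inter> U \<times> U \<subseteq> (H \<inter> ?U \<times> ?U) \<union> (Pair u ` ?N \<union> (\<lambda>v. (v, u)) ` ?N)"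
      using \<open>sym H\<close> by (auto dest: symD)
    then have "card (H \<inter> U \<times> U) \<le> card ((H \<inter> ?U \<times> ?U) \<union> (Pair u ` ?N \<union> (\<lambda>v. (v, u)) ` ?N))"
      using less.prems(1) by (intro card_mono) auto
    also have "\<dots> \<le> card (H \<inter> ?U \<times> ?U) + (card ?N + card ?N)"
      using less.prems(1) by (intro order_trans[OF card_Un_le] add_mono card_image_le) auto
    also have "\<dots> \<le> card (H \<inter> ?U \<times> ?U) + 2 * d" using u by simp
    finally have "2 * d * card ?U < card (H \<inter> ?U \<times> ?U)"
      using less.prems u by (cases "card U") (auto simp: algebra_simps)
    moreover have "card ?U < card U" using less.prems u by (meson card_Diff1_less)
    ultimately obtain W where "W \<subseteq> ?U" "W \<noteq> {}" "\<forall>u\<in>W. d < card {v \<in> W. (u, v) \<in> H}"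
      using less.hyps[of ?U] less.prems by blast
    then show ?thesis by blast
  qed
qed

text \<open>The last vertex of a path on at most \<open>d\<close> vertices has a neighbour off the path.\<close>

lemma path_of_min_degree:
  assumes "finite W" "\<And>u. u \<in> W \<Longrightarrow> d < card {v \<in> W. (u, v) \<in> H}" "u \<in> W" "j \<le> d"
  shows "\<exists>q. simple_path H q \<and> length q = Suc j \<and> hd q = u \<and> set q \<subseteq> W"
  using assms(4)
proof (induction j)
  case 0
  then show ?case using assms(3) by (intro exI[of _ "[u]"]) (simp add: simple_path_def)
next
  case (Suc j)
  then obtain q where q: "simple_path H q" "length q = Suc j" "hd q = u" "set q \<subseteq> W" by auto
  have ne: "q \<noteq> []" using q by auto
  then have "last q \<in> W" using q last_in_set by blast
  then have "card (set q) < card {v \<in> W. (last q, v) \<in> H}"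
    using q(2) assms(2)[of "last q"] Suc.prems card_length[of q] by linarith
  then obtain v where "v \<in> W" "(last q, v) \<in> H" "v \<notin> set q"
    using card_mono[of "set q" "{v \<in> W. (last q, v) \<in> H}"] by fastforce
  then show ?case
    using q ne by (intro exI[of _ "q @ [v]"]) (auto simp: simple_path_def successively_append_iff)
qed

text \<open>
  Colour coding. Item \<open>i\<close> prescribes the colours of at most \<open>s\<close> vertices, and a uniformly random
  colouring meets this prescription with probability at least \<open>card C ^ (- s)\<close>. Some colouring
  attains the average.
\<close>

lemma exists_good_coloring:
  fixes g :: "'i \<Rightarrow> 'a \<Rightarrow> 'c"
  assumes fin: "finite I" "finite V" "finite C" and ne: "C \<noteq> {}"
    and Q: "\<And>i. i \<in> I \<Longrightarrow> Q i \<subseteq> V" "\<And>i. i \<in> I \<Longrightarrow> card (Q i) \<le> s"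
    and g: "\<And>i x. i \<in> I \<Longrightarrow> x \<in> Q i \<Longrightarrow> g i x \<in> C"
  shows "\<exists>c. card I \<le> card C ^ s * card {i \<in> I. \<forall>x\<in>Q i. c x = g i x}"
proof (rule ccontr)
  define F where "F = (\<Pi>\<^sub>E x\<in>V. C)"
  assume "\<not> ?thesis"
  then have *: "card C ^ s * card {i \<in> I. \<forall>x\<in>Q i. c x = g i x} < card I" for c
    by (meson linorder_not_le)
  have F: "finite F" "F \<noteq> {}"
    using fin ne by (auto simp: F_def PiE_eq_empty_iff intro!: finite_PiE)
  have q: "card C > 0" using fin ne by (simp add: card_gt_0_iff)
  have "card F \<le> card C ^ s * card {c \<in> F. \<forall>x\<in>Q i. c x = g i x}" if "i \<in> I" for i
  proof -
    have finQ: "finite (Q i)" using Q(1)[OF that] fin finite_subset by blast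
    have "{c \<in> F. \<forall>x\<in>Q i. c x = g i x} = (\<Pi>\<^sub>E x\<in>V. if x \<in> Q i then {g i x} else C)"
      using Q(1)[OF that] g[OF that]
      by (auto simp: F_def PiE_iff extensional_def split: if_splits)
    then have "card {c \<in> F. \<forall>x\<in>Q i. c x = g i x} = (\<Prod>x\<in>V. card (if x \<in> Q i then {g i x} else C))"
      using fin by (simp add: card_PiE)
    also have "\<dots> = (\<Prod>x\<in>V - Q i. card C)"
      using fin by (intro prod.mono_neutral_cong_right) auto
    also have "\<dots> = card C ^ card (V - Q i)" by simp
    finally have "card C ^ s * card {c \<in> F. \<forall>x\<in>Q i. c x = g i x} = card C ^ (s + card (V - Q i))"
      by (simp add: power_add)
    moreover have "card V \<le> s + card (V - Q i)"
      using Q[OF that] fin finQ by (simp add: card_Diff_subset)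
    moreover have "card F = card C ^ card V" using fin by (simp add: F_def card_PiE)
    ultimately show ?thesis using q by (simp add: power_increasing)
  qed
  then have "(\<Sum>i\<in>I. card F) \<le> (\<Sum>i\<in>I. card C ^ s * card {c \<in> F. \<forall>x\<in>Q i. c x = g i x})"
    by (rule sum_mono)
  also have "\<dots> = card C ^ s * (\<Sum>i\<in>I. card {c \<in> F. \<forall>x\<in>Q i. c x = g i x})"
    by (simp add: sum_distrib_left)
  also have "(\<Sum>i\<in>I. card {c \<in> F. \<forall>x\<in>Q i. c x = g i x}) = (\<Sum>c\<in>F. card {i \<in> I. \<forall>x\<in>Q i. c x = g i x})"
    by (rule sum_multicount_gen[OF fin(1) F(1)]) simp
  also have "card C ^ s * \<dots> = (\<Sum>c\<in>F. card C ^ s * card {i \<in> I. \<forall>x\<in>Q i. c x = g i x})"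
    by (simp add: sum_distrib_left)
  also have "\<dots> < (\<Sum>c\<in>F. card I)"
    using F * by (intro sum_strict_mono)
  finally show False by (simp add: mult.commute)
qed

section \<open>Antipodes on odd cycles\<close>

lemma antipodes_subset: "E \<subseteq> V \<times> V \<Longrightarrow> antipodes k E w \<subseteq> V"
  using simple_cycle_subset_Domain unfolding antipodes_def by fastforce

text \<open>Read the cycle from \<open>z\<close> in the opposite direction.\<close>

lemma antipode_sym:
  assumes "sym E" "1 \<le> k" "z \<in> antipodes k E w"
  shows "w \<in> antipodes k E z"
proof -
  from assms(3) obtain as bs where *: "length as = k - 1" "length bs = k" "simple_cycle E (w # as @ z # bs)"
    by (auto simp: antipodes_def)
  from *(3) have "simple_cycle E (z # bs @ w # as)"
    using simple_cycle_swap[of E "w # as" "z # bs"] by simp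
  then have "simple_cycle E (z # rev as @ w # rev bs)"
    using simple_cycle_reverse_tail[OF assms(1), of z "bs @ w # as"] by simp
  with * show ?thesis unfolding antipodes_def by (metis (mono_tags, lifting) length_rev mem_Collect_eq)
qed

text \<open>
  The factor in the degree bound for antipodes. Colour coding with four colours on \<open>2 k + 1\<close>
  vertices costs the power, a graph without a path of \<open>2 m\<close> edges has average degree at most \<open>4 m\<close>,
  and \<open>2 k + 1\<close> accounts for the edges from an antipode into its own cycle.
\<close>

definition expansion_const :: "nat \<Rightarrow> nat \<Rightarrow> nat" where
  "expansion_const k m = 4 ^ (2 * k + 1) * (2 * m) + 2 * k + 1"

lemma expansion_const_ge_1: "1 \<le> expansion_const k m"
  by (simp add: expansion_const_def)

text \<open>
  The antipodes of \<open>w\<close> span few edges towards any set \<open>S\<close>. For each antipode \<open>z\<close> fix a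
  \<open>(2 k + 1)\<close>-cycle through \<open>w\<close> and \<open>z\<close>; it consists of an arc \<open>A z\<close> with \<open>k - 1\<close> interior
  vertices and an arc \<open>B z\<close> with \<open>k\<close> interior vertices. Colour the vertices so that, for a constant
  proportion of the edges \<open>zy\<close> in question, \<open>z\<close> has colour 0, \<open>A z\<close> colour 1, \<open>B z\<close> colour 2 and
  \<open>y\<close> colour 3. If many such edges exist, they contain a path with \<open>2 m\<close> edges from a
  vertex \<open>u\<close> to a vertex \<open>z\<close>, both of colour 0. The long arc from \<open>w\<close> to \<open>u\<close>, this path and the
  short arc from \<open>z\<close> back to \<open>w\<close> are disjoint because of their colours, and close up to a cycle
  of length \<open>(k + 1) + 2 m + k\<close>.
\<close>

lemma antipode_degree_sum:
  fixes E :: "('a \<times> 'a) set"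
  assumes E: "sym E" and V: "finite V" "E \<subseteq> V \<times> V" and S: "S \<subseteq> V" and "1 \<le> k"
    and no: "\<And>p. simple_cycle E p \<Longrightarrow> length p \<noteq> 2 * k + 2 * m + 1"
  shows "(\<Sum>z\<in>antipodes k E w. card {y \<in> S. (z, y) \<in> E})
    \<le> expansion_const k m * (card (antipodes k E w) + card S)"
proof -
  define Z where "Z = antipodes k E w"
  have ZV: "Z \<subseteq> V" using antipodes_subset[OF V(2)] by (simp add: Z_def)
  have finZ: "finite Z" and finS: "finite S"
    using ZV S V(1) by (auto intro: finite_subset)
  have "\<forall>z\<in>Z. \<exists>as bs. length as = k - 1 \<and> length bs = k \<and> simple_cycle E (w # as @ z # bs)"
    by (auto simp: Z_def antipodes_def)
  then obtain A B where AB: "\<And>z. z \<in> Z \<Longrightarrow> length (A z) = k - 1" "\<And>z. z \<in> Z \<Longrightarrow> length (B z) = k"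
    "\<And>z. z \<in> Z \<Longrightarrow> simple_cycle E (w # A z @ z # B z)"
    by metis
  define C where "C z = w # A z @ z # B z" for z
  have C: "distinct (C z)" "set (C z) \<subseteq> V" if "z \<in> Z" for z
    using AB(3)[OF that] simple_cycle_subset_Domain[OF AB(3)[OF that]] V
    by (auto simp: C_def simple_cycle_def simple_path_def)
  define I where "I = (SIGMA z:Z. {y \<in> S. (z, y) \<in> E \<and> y \<notin> set (C z)})"
  define Q where "Q = (\<lambda>(z, y). insert y (insert z (set (A z) \<union> set (B z))))"
  define g :: "'a \<times> 'a \<Rightarrow> 'a \<Rightarrow> nat" where
    "g = (\<lambda>(z, y) x. if x = z then 0 else if x \<in> set (A z) then 1 else if x \<in> set (B z) then 2 else 3)"
  have "finite I" using finZ finS by (auto simp: I_def)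
  moreover have "Q i \<subseteq> V" if "i \<in> I" for i
  proof -
    obtain z y where i: "i = (z, y)" "z \<in> Z" "y \<in> S" using \<open>i \<in> I\<close> by (auto simp: I_def)
    then show ?thesis using C(2)[OF i(2)] S by (auto simp: Q_def C_def)
  qed
  moreover have "card (Q i) \<le> 2 * k + 1" if "i \<in> I" for i
  proof -
    obtain z y where i: "i = (z, y)" "z \<in> Z" using \<open>i \<in> I\<close> by (auto simp: I_def)
    have "Q i = set (y # z # A z @ B z)" by (auto simp: Q_def i)
    also have "card \<dots> \<le> length (y # z # A z @ B z)" by (rule card_length)
    also have "\<dots> = 2 * k + 1" using AB(1,2)[OF i(2)] \<open>1 \<le> k\<close> by simp
    finally show ?thesis .
  qed
  moreover have "g i x \<in> {0..<4}" for i x by (simp add: g_def split: prod.split)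
  ultimately obtain c where c: "card I \<le> card {0..<4::nat} ^ (2 * k + 1) * card {i \<in> I. \<forall>x\<in>Q i. c x = g i x}"
    using exists_good_coloring[of I V "{0..<4::nat}" Q "2 * k + 1" g] V(1) by fastforce
  define H where "H = {i \<in> I. \<forall>x\<in>Q i. c x = g i x}"
  have H: "z \<in> Z" "y \<in> S" "(z, y) \<in> E" "y \<noteq> w" "z \<noteq> w" "c z = 0" "c y = 3"
    "\<forall>x\<in>set (A z). c x = 1" "\<forall>x\<in>set (B z). c x = 2" if "(z, y) \<in> H" for z y
  proof -
    show zy: "z \<in> Z" "y \<in> S" "(z, y) \<in> E" using that by (auto simp: H_def I_def)
    have y: "y \<notin> set (C z)" using that by (auto simp: H_def I_def)
    have col: "c x = g (z, y) x" if "x \<in> insert y (insert z (set (A z) \<union> set (B z)))" for x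
      using \<open>(z, y) \<in> H\<close> that unfolding H_def Q_def by blast
    show "y \<noteq> w" "z \<noteq> w" "c z = 0" "c y = 3" "\<forall>x\<in>set (A z). c x = 1" "\<forall>x\<in>set (B z). c x = 2"
      using y C(1)[OF zy(1)] by (auto simp: C_def col g_def)
  qed
  have finH: "finite H" using \<open>finite I\<close> by (simp add: H_def)
  have cardH: "card H \<le> 2 * m * (card Z + card S)"
  proof (rule ccontr)
    assume many: "\<not> ?thesis"
    \<comment> \<open>A path in \<open>F\<close> alternates between the colours 0 and 3, so one of even length that starts in
      colour 0 also ends there. Such an end has colour 0, thus it is an antipode whose arcs have
      the prescribed colours.\<close>
    define F where "F = H \<union> H\<inverse>"
    have "sym F" by (auto simp: F_def sym_def)
    have FE: "F \<subseteq> E" using H(3) E by (auto simp: F_def dest: symD)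
    have "H \<inter> H\<inverse> = {}" using H(6,7) by fastforce
    then have "card F = 2 * card H" using finH by (simp add: F_def card_Un_disjoint)
    moreover have "F \<inter> (Z \<union> S) \<times> (Z \<union> S) = F" using H(1,2) by (auto simp: F_def)
    moreover have "2 * m * card (Z \<union> S) \<le> 2 * m * (card Z + card S)"
      by (rule mult_le_mono2[OF card_Un_le])
    then have "2 * m * card (Z \<union> S) < card H" using many by linarith
    ultimately have "2 * (2 * m) * card (Z \<union> S) < card (F \<inter> (Z \<union> S) \<times> (Z \<union> S))"
      by (simp only: mult.assoc)
    from dense_subset[OF \<open>sym F\<close> _ this] finZ finS obtain W where
      W: "W \<subseteq> Z \<union> S" "W \<noteq> {}" "\<And>u. u \<in> W \<Longrightarrow> 2 * m < card {v \<in> W. (u, v) \<in> F}"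
      by blast
    have nbr: "\<exists>v\<in>W. (u, v) \<in> F" if "u \<in> W" for u
      using W(3)[OF that] by (metis (mono_tags, lifting) card.empty empty_Collect_eq not_less_zero)
    have zero: "\<exists>y. (u, y) \<in> H" if "u \<in> W" "c u = 0" for u
      using nbr[OF that(1)] that(2) H(7) by (fastforce simp: F_def)
    have step: "c u = 0 \<and> c v = 3 \<or> c u = 3 \<and> c v = 0" if "(u, v) \<in> F" for u v
      using that H(6,7) by (auto simp: F_def)
    have W': "c u = 0 \<or> c u = 3" "u \<noteq> w" if "u \<in> W" for u
    proof -
      obtain v where v: "(u, v) \<in> F" using nbr \<open>u \<in> W\<close> by blast
      show "c u = 0 \<or> c u = 3" using step[OF v] by blast
      show "u \<noteq> w" using v H(4,5) by (auto simp: F_def)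
    qed
    obtain u where u: "u \<in> W" "c u = 0"
    proof -
      obtain x where x: "x \<in> W" using W(2) by blast
      then obtain y where y: "y \<in> W" "(x, y) \<in> F" using nbr by blast
      show ?thesis using step[OF y(2)] x y(1) that by blast
    qed
    obtain q where q: "simple_path F q" "length q = Suc (2 * m)" "hd q = u" "set q \<subseteq> W"
      using path_of_min_degree[of W "2 * m" F u "2 * m"] W u finZ finS finite_subset[OF W(1)] by auto
    have "q \<noteq> []" using q(2) by auto
    have succF: "(q ! i, q ! Suc i) \<in> F" if "Suc i < length q" for i
      using q(1) that by (simp add: simple_path_def successively_conv_nth)
    have "c (q ! i) = (if even i then 0 else 3)" if "i < length q" for i
      using that
    proof (induction i)
      case 0
      then show ?case using q(3) u(2) \<open>q \<noteq> []\<close> by (simp add: hd_conv_nth)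
    next
      case (Suc i)
      then show ?case using step[OF succF[of i]] by (auto split: if_splits)
    qed
    from this[of "2 * m"] have "c (last q) = 0"
      using q(2) \<open>q \<noteq> []\<close> by (simp add: last_conv_nth)
    define z where "z = last q"
    have z: "z \<in> W" "c z = 0" using q(4) \<open>q \<noteq> []\<close> \<open>c (last q) = 0\<close> by (auto simp: z_def)
    from zero[OF u] zero[OF z] obtain y y' where yy: "(u, y) \<in> H" "(z, y') \<in> H" by blast
    have uZ: "u \<in> Z" and zZ: "z \<in> Z" using yy H(1) by auto
    define D where "D = (w # rev (B u)) @ q @ rev (A z)"
    have cu: "simple_cycle E ((w # rev (B u)) @ u # rev (A u))"
      using simple_cycle_reverse_tail[OF E AB(3)[OF uZ]] by simp
    have cz: "simple_cycle E ((w # rev (B z)) @ z # rev (A z))"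
      using simple_cycle_reverse_tail[OF E AB(3)[OF zZ]] by simp
    have q_succ: "successively (\<lambda>x y. (x, y) \<in> E) q"
      using q(1) FE by (auto simp: simple_path_def elim!: successively_mono)
    have "successively (\<lambda>x y. (x, y) \<in> E) D"
    proof -
      have "successively (\<lambda>x y. (x, y) \<in> E) (w # rev (B u))" "(last (w # rev (B u)), u) \<in> E"
        using cu unfolding simple_cycle_def simple_path_def successively_append_iff by auto
      moreover have "successively (\<lambda>x y. (x, y) \<in> E) (rev (A z))" "A z \<noteq> [] \<Longrightarrow> (z, hd (rev (A z))) \<in> E"
        using cz unfolding simple_cycle_def simple_path_def successively_append_iff successively_Cons by auto
      ultimately show ?thesis
        using q_succ q(3) \<open>q \<noteq> []\<close> unfolding D_def successively_append_iff z_def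
        by (auto simp: hd_append simp del: successively_rev)
    qed
    moreover have "(last D, hd D) \<in> E"
      using cz \<open>q \<noteq> []\<close> by (auto simp: D_def simple_cycle_def z_def split: if_splits)
    moreover have "distinct D"
    proof -
      have "distinct (w # B u)" "distinct (w # A z)"
        using C(1)[OF uZ] C(1)[OF zZ] by (auto simp: C_def)
      moreover have "\<forall>x\<in>set (B u). c x = 2" "\<forall>x\<in>set (A z). c x = 1"
        using H(8,9) yy by blast+
      moreover have "\<forall>x\<in>set q. (c x = 0 \<or> c x = 3) \<and> x \<noteq> w" using W' q(4) by blast
      moreover have "distinct q" using q(1) by (simp add: simple_path_def)
      ultimately show ?thesis unfolding D_def by fastforce
    qed
    ultimately have "simple_cycle E D" by (simp add: simple_cycle_def simple_path_def D_def)
    moreover have "length D = 2 * k + 2 * m + 1"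
      using AB(1)[OF zZ] AB(2)[OF uZ] q(2) \<open>1 \<le> k\<close> by (simp add: D_def)
    ultimately show False using no by blast
  qed
  \<comment> \<open>An edge from an antipode into its own chosen cycle is left out of the colouring; each antipode has at most
    \<open>2 k + 1\<close> of them.\<close>
  have "(\<Sum>z\<in>Z. card {y \<in> S. (z, y) \<in> E})
      \<le> (\<Sum>z\<in>Z. card {y \<in> S. (z, y) \<in> E \<and> y \<notin> set (C z)} + (2 * k + 1))"
  proof (rule sum_mono)
    fix z assume "z \<in> Z"
    have "card {y \<in> S. (z, y) \<in> E} \<le> card ({y \<in> S. (z, y) \<in> E \<and> y \<notin> set (C z)} \<union> set (C z))"
      using finS by (intro card_mono) auto
    also have "\<dots> \<le> card {y \<in> S. (z, y) \<in> E \<and> y \<notin> set (C z)} + card (set (C z))"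
      by (rule card_Un_le)
    also have "card (set (C z)) \<le> 2 * k + 1"
      using card_length[of "C z"] AB(1,2)[OF \<open>z \<in> Z\<close>] \<open>1 \<le> k\<close> by (simp add: C_def)
    finally show "card {y \<in> S. (z, y) \<in> E}
      \<le> card {y \<in> S. (z, y) \<in> E \<and> y \<notin> set (C z)} + (2 * k + 1)" by simp
  qed
  also have "\<dots> = card I + (2 * k + 1) * card Z"
    using finZ finS unfolding sum.distrib by (simp add: I_def)
  also have "\<dots> \<le> 4 ^ (2 * k + 1) * (2 * m * (card Z + card S)) + (2 * k + 1) * (card Z + card S)"
  proof (rule add_mono)
    have "card I \<le> 4 ^ (2 * k + 1) * card H" using c by (simp add: H_def)
    also have "\<dots> \<le> 4 ^ (2 * k + 1) * (2 * m * (card Z + card S))" using cardH by (rule mult_le_mono2)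
    finally show "card I \<le> 4 ^ (2 * k + 1) * (2 * m * (card Z + card S))" .
  qed (intro mult_le_mono2 le_add1)
  finally show ?thesis by (simp add: Z_def expansion_const_def algebra_simps)
qed

lemma odd_cycle_decompose:
  assumes "length p = 2 * k + 1" "1 \<le> k"
  shows "\<exists>w as z z' bs. p = w # as @ z # z' # bs \<and> length as = k - 1 \<and> length bs = k - 1"
proof -
  obtain w p1 where p: "p = w # p1" "length p1 = 2 * k" using assms by (cases p) auto
  obtain z p2 where p2: "drop (k - 1) p1 = z # p2" "length p2 = k"
  proof (cases "drop (k - 1) p1")
    case Nil
    then show ?thesis using p assms by simp
  next
    case (Cons z p2)
    from arg_cong[OF this, of length] have "length p2 = k" using p assms by simp
    then show ?thesis using Cons that by blast
  qed
  obtain z' bs where bs: "p2 = z' # bs" using p2 assms by (cases p2) auto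
  have "p1 = take (k - 1) p1 @ z # z' # bs" using p2 bs by (metis append_take_drop_id)
  then show ?thesis using p p2 bs assms by (intro exI[of _ w] exI[of _ "take (k - 1) p1"] exI[of _ z] exI[of _ z'] exI[of _ bs]) auto
qed

text \<open>Both arcs from \<open>w\<close> to the opposite edge \<open>zz'\<close> have length \<open>k\<close>, hence are unique.\<close>

lemma cycle_determined_by_opposite_edge:
  assumes E: "sym E" and short: "\<And>p. simple_cycle E p \<Longrightarrow> 3 \<le> length p \<Longrightarrow> 2 * k < length p"
    and p: "simple_cycle E (w # as @ z # z' # bs)" "length as = k - 1" "length bs = k - 1"
    and q: "simple_cycle E (w # as2 @ z # z' # bs2)" "length as2 = k - 1" "length bs2 = k - 1"
    and k: "1 \<le> k"
  shows "as = as2 \<and> bs = bs2"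
proof
  have path1: "simple_path E (w # as @ [z])" if "simple_cycle E (w # as @ z # z' # bs)" for as bs
    using that successively_append_iff[of "\<lambda>x y. (x, y) \<in> E" "w # as @ [z]" "z' # bs"]
    by (auto simp: simple_cycle_def simple_path_def)
  have path2: "simple_path E (z' # bs @ [w])" if "simple_cycle E (w # as @ z # z' # bs)" for as bs
    using path1[of "bs" as] that simple_cycle_swap[of E "w # as @ [z]" "z' # bs"]
      successively_append_iff[of "\<lambda>x y. (x, y) \<in> E" "z' # bs @ [w]" "as @ [z]"]
    by (auto simp: simple_cycle_def simple_path_def)
  show "as = as2"
    using cycle_from_two_paths[OF E path1[OF p(1)] path1[OF q(1)]] p q k
      short by fastforce
  show "bs = bs2"
    using cycle_from_two_paths[OF E path2[OF p(1)] path2[OF q(1)]] p q k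
      short by fastforce
qed

text \<open>
  A cycle through \<open>w\<close> is determined by its opposite edge, whose two ends are antipodes of \<open>w\<close>;
  so the degree bound applies with the set of antipodes itself in the place of \<open>S\<close>.
\<close>

lemma cycles_through_vertex:
  fixes E :: "('a \<times> 'a) set"
  assumes E: "sym E" and V: "finite V" "E \<subseteq> V \<times> V" and k: "1 \<le> k"
    and short: "\<And>p. simple_cycle E p \<Longrightarrow> 3 \<le> length p \<Longrightarrow> 2 * k < length p"
    and no: "\<And>p. simple_cycle E p \<Longrightarrow> length p \<noteq> 2 * k + 2 * m + 1"
  shows "card {p \<in> cycles (2 * k + 1) E. p ! 0 = w}
    \<le> 2 * expansion_const k m * card (antipodes k E w)"
proof -
  let ?Z = "antipodes k E w" and ?L = "{p \<in> cycles (2 * k + 1) E. p ! 0 = w}"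
  let ?f = "\<lambda>p :: 'a list. (p ! k, p ! Suc k)"
  have finZ: "finite ?Z" using antipodes_subset[OF V(2)] V(1) finite_subset by blast
  have dec: "\<exists>as z z' bs. p = w # as @ z # z' # bs \<and> length as = k - 1 \<and> length bs = k - 1
      \<and> simple_cycle E (w # as @ z # z' # bs) \<and> ?f p = (z, z')" if "p \<in> ?L" for p
  proof -
    from that have p: "length p = 2 * k + 1" "simple_cycle E p" "p ! 0 = w" by (auto simp: cycles_def)
    from odd_cycle_decompose[OF p(1) k] obtain w' as z z' bs where
      d: "p = w' # as @ z # z' # bs" "length as = k - 1" "length bs = k - 1" by blast
    have "w' = w" using p(3) d(1) by simp
    moreover have "?f p = (z, z')" using k d by (cases k) (auto simp: nth_append)
    ultimately show ?thesis using p(2) d by blast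
  qed
  have "inj_on ?f ?L"
  proof (rule inj_onI)
    fix p q assume pq: "p \<in> ?L" "q \<in> ?L" "?f p = ?f q"
    from dec[OF pq(1)] dec[OF pq(2)] pq(3) show "p = q"
      using cycle_determined_by_opposite_edge[OF E short] k by (smt (verit) prod.inject)
  qed
  moreover have "?f ` ?L \<subseteq> (SIGMA z:?Z. {y \<in> ?Z. (z, y) \<in> E})"
  proof
    fix e assume "e \<in> ?f ` ?L"
    then obtain as z z' bs where d: "e = (z, z')" "length as = k - 1" "length bs = k - 1"
      and c: "simple_cycle E (w # as @ z # z' # bs)"
      using dec by (smt (verit) imageE)
    have "z \<in> ?Z" using d c k unfolding antipodes_def by (intro CollectI exI[of _ as] exI[of _ "z' # bs"]) auto
    moreover have "simple_cycle E (w # rev bs @ z' # z # rev as)"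
      using simple_cycle_reverse_tail[OF E c] by simp
    then have "z' \<in> ?Z" using d k unfolding antipodes_def by (intro CollectI exI[of _ "rev bs"] exI[of _ "z # rev as"]) auto
    moreover have "(z, z') \<in> E"
      using c successively_append_iff[of "\<lambda>x y. (x, y) \<in> E" "w # as" "z # z' # bs"]
      by (auto simp: simple_cycle_def simple_path_def)
    ultimately show "e \<in> (SIGMA z:?Z. {y \<in> ?Z. (z, y) \<in> E})" using d by auto
  qed
  ultimately have "card ?L \<le> card (SIGMA z:?Z. {y \<in> ?Z. (z, y) \<in> E})"
    using finZ by (intro card_inj_on_le) auto
  also have "\<dots> = (\<Sum>z\<in>?Z. card {y \<in> ?Z. (z, y) \<in> E})" using finZ by simp
  also have "\<dots> \<le> expansion_const k m * (card ?Z + card ?Z)"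
    by (rule antipode_degree_sum[OF E V antipodes_subset[OF V(2)] k no])
  finally show ?thesis by (simp add: algebra_simps)
qed

text \<open>An antipode of \<open>w\<close> is reached from \<open>w\<close> by a walk of length \<open>k\<close>.\<close>

lemma antipodes_bounded_degree:
  assumes deg: "\<And>x. real (card {y. (x, y) \<in> E}) \<le> D" and fin: "finite E" and k: "1 \<le> k"
  shows "real (card (antipodes k E w)) \<le> D ^ k"
proof -
  have D: "0 \<le> D" using deg[of undefined] by linarith
  have fin': "finite ((E ^^ j) `` {w})" for j
    by (induction j) (auto simp: relcomp_Image intro!: finite_Image fin)
  have walk: "real (card ((E ^^ j) `` {w})) \<le> D ^ j" for j
  proof (induction j)
    case (Suc j)
    have "(E ^^ Suc j) `` {w} = (\<Union>x\<in>(E ^^ j) `` {w}. {y. (x, y) \<in> E})" by auto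
    then have "card ((E ^^ Suc j) `` {w}) \<le> (\<Sum>x\<in>(E ^^ j) `` {w}. card {y. (x, y) \<in> E})"
      using fin' by (metis card_UN_le)
    then have "real (card ((E ^^ Suc j) `` {w})) \<le> (\<Sum>x\<in>(E ^^ j) `` {w}. real (card {y. (x, y) \<in> E}))"
      by (metis of_nat_le_iff of_nat_sum)
    also have "\<dots> \<le> real (card ((E ^^ j) `` {w})) * D"
      using deg by (rule sum_bounded_above)
    also have "\<dots> \<le> D ^ j * D" using Suc D by (rule mult_right_mono)
    finally show ?case by (simp add: mult.commute)
  qed simp
  have reach: "(x, last (x # p)) \<in> E ^^ length p" if "successively (\<lambda>x y. (x, y) \<in> E) (x # p)" for x p
    using that
  proof (induction p arbitrary: x)
    case (Cons y p)
    then have "(x, y) \<in> E" "(y, last (y # p)) \<in> E ^^ length p" by (auto simp: successively_Cons)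
    then show ?case by (metis last_ConsR length_Cons list.distinct(1) relpow_Suc_I2)
  qed simp
  have "antipodes k E w \<subseteq> (E ^^ k) `` {w}"
  proof
    fix z assume "z \<in> antipodes k E w"
    then obtain as bs where *: "length as = k - 1" "simple_cycle E ((w # as @ [z]) @ bs)"
      by (auto simp: antipodes_def)
    then have "successively (\<lambda>x y. (x, y) \<in> E) (w # as @ [z])"
      unfolding simple_cycle_def simple_path_def successively_append_iff by blast
    from reach[OF this] show "z \<in> (E ^^ k) `` {w}" using * k by simp
  qed
  then have "card (antipodes k E w) \<le> card ((E ^^ k) `` {w})" using fin' by (rule card_mono[rotated])
  then show ?thesis using walk[of k] by linarith
qed

section \<open>Counting odd cycles\<close>

lemma sum_card_fibres:
  assumes "finite A" "finite Y"
  shows "(\<Sum>y\<in>Y. card {x \<in> A. f x = y}) = card {x \<in> A. f x \<in> Y}"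
proof -
  have "{x \<in> A. f x \<in> Y} = (\<Union>y\<in>Y. {x \<in> A. f x = y})" by auto
  also have "card \<dots> = (\<Sum>y\<in>Y. card {x \<in> A. f x = y})"
    using assms by (intro card_UN_disjoint) auto
  finally show ?thesis by simp
qed

text \<open>Rotation by \<open>i\<close> turns a condition on the \<open>i\<close>-th arc of a cycle into one on its first arc.\<close>

lemma card_cycles_rotate:
  assumes "finite (cycles r E)" "i < r" "2 \<le> r"
  shows "card {p \<in> cycles r E. P (p ! i) (p ! (Suc i mod r))} \<le> card {p \<in> cycles r E. P (p ! 0) (p ! 1)}"
proof (rule card_inj_on_le)
  show "inj_on (\<lambda>p. drop i p @ take i p) {p \<in> cycles r E. P (p ! i) (p ! (Suc i mod r))}"
  proof (rule inj_onI)
    fix p q :: "'a list" assume "p \<in> {p \<in> cycles r E. P (p ! i) (p ! (Suc i mod r))}"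
      "q \<in> {p \<in> cycles r E. P (p ! i) (p ! (Suc i mod r))}" "drop i p @ take i p = drop i q @ take i q"
    then have "drop i p = drop i q" "take i p = take i q" by (auto simp: cycles_def)
    then show "p = q" by (metis append_take_drop_id)
  qed
  show "(\<lambda>p. drop i p @ take i p) ` {p \<in> cycles r E. P (p ! i) (p ! (Suc i mod r))}
      \<subseteq> {p \<in> cycles r E. P (p ! 0) (p ! 1)}"
  proof (rule image_subsetI)
    fix p assume "p \<in> {p \<in> cycles r E. P (p ! i) (p ! (Suc i mod r))}"
    then have p: "length p = r" "simple_cycle E p" "P (p ! i) (p ! (Suc i mod r))"
      by (auto simp: cycles_def)
    have rot: "drop i p @ take i p = rotate i p"
      using p assms by (simp add: rotate_drop_take)
    have "rotate i p ! 0 = p ! i" "rotate i p ! 1 = p ! (Suc i mod r)"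
      using nth_rotate[of 0 p i] nth_rotate[of 1 p i] p(1) assms(2,3) by simp_all
    moreover have "simple_cycle E (drop i p @ take i p)"
      using simple_cycle_swap[of E "take i p" "drop i p"] p(2) by simp
    ultimately show "drop i p @ take i p \<in> {p \<in> cycles r E. P (p ! 0) (p ! 1)}"
      using p by (simp add: cycles_def rot)
  qed
qed (use assms in auto)

lemma cycles_by_start:
  assumes "finite V" "E \<subseteq> V \<times> V" "0 < r"
  shows "card (cycles r E) = (\<Sum>v\<in>V. card {p \<in> cycles r E. p ! 0 = v})"
proof -
  have "p ! 0 \<in> V" if "p \<in> cycles r E" for p
  proof -
    have "length p = r" "set p \<subseteq> Domain E"
      using that simple_cycle_subset_Domain by (auto simp: cycles_def)
    then show ?thesis using assms(2,3) nth_mem[of 0 p] by blast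
  qed
  then have "{p \<in> cycles r E. p ! 0 \<in> V} = cycles r E" by auto
  then show ?thesis using sum_card_fibres[OF finite_cycles[OF assms(1,2)] assms(1), of r "\<lambda>p. p ! 0"] by simp
qed

text \<open>
  Count the pairs of antipodes \<open>w, x\<close>, weighted with the degree of \<open>x\<close>. Seen from \<open>w\<close>, the degrees
  of its antipodes sum to a linear quantity. Being antipodes is symmetric, so the same
  total is also the sum of \<open>deg x\<close> times the number of antipodes of \<open>x\<close>. Vertices with
  many antipodes therefore have small degree on average.
\<close>

lemma heavy_degree_sum:
  fixes E :: "('a \<times> 'a) set"
  assumes E: "sym E" and V: "finite V" "E \<subseteq> V \<times> V" and k: "1 \<le> k"
    and no: "\<And>p. simple_cycle E p \<Longrightarrow> length p \<noteq> 2 * k + 2 * m + 1"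
    and U: "U \<subseteq> V" "\<And>v. v \<in> U \<Longrightarrow> s \<le> real (card (antipodes k E v))"
  shows "s * real (card {e \<in> E. fst e \<in> U}) \<le> 2 * real (expansion_const k m) * real (card V) ^ 2"
proof -
  let ?Z = "antipodes k E" and ?n = "real (card V)"
  define deg where "deg x = card {y \<in> V. (x, y) \<in> E}" for x
  have finU: "finite U" using U V finite_subset by blast
  have ZV: "?Z w \<subseteq> V" for w by (rule antipodes_subset[OF V(2)])
  have "{e \<in> E. fst e \<in> U} = (SIGMA x:U. {y \<in> V. (x, y) \<in> E})" using V(2) by auto
  then have arcs: "card {e \<in> E. fst e \<in> U} = (\<Sum>x\<in>U. deg x)"
    using finU V(1) by (simp add: deg_def)
  have "s * real (card {e \<in> E. fst e \<in> U}) = (\<Sum>x\<in>U. s * real (deg x))"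
    by (simp add: arcs sum_distrib_left)
  also have "\<dots> \<le> (\<Sum>x\<in>U. real (card (?Z x)) * real (deg x))"
    using U(2) by (intro sum_mono mult_right_mono) auto
  also have "\<dots> \<le> (\<Sum>x\<in>V. real (card (?Z x)) * real (deg x))"
    using U(1) V(1) by (intro sum_mono2) auto
  also have "\<dots> = (\<Sum>x\<in>V. \<Sum>w\<in>{w \<in> V. w \<in> ?Z x}. real (deg x))"
  proof (rule sum.cong)
    fix x
    have "{w \<in> V. w \<in> ?Z x} = ?Z x" using ZV by blast
    then show "real (card (?Z x)) * real (deg x) = (\<Sum>w\<in>{w \<in> V. w \<in> ?Z x}. real (deg x))" by simp
  qed simp
  also have "\<dots> = (\<Sum>w\<in>V. \<Sum>x\<in>{x \<in> V. w \<in> ?Z x}. real (deg x))"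
    by (rule sum.swap_restrict[OF V(1) V(1)])
  also have "\<dots> \<le> (\<Sum>w\<in>V. 2 * real (expansion_const k m) * ?n)"
  proof (rule sum_mono)
    fix w
    have "{x \<in> V. w \<in> ?Z x} = ?Z w" using ZV antipode_sym[OF E k] by blast
    then have "(\<Sum>x\<in>{x \<in> V. w \<in> ?Z x}. real (deg x)) = real (\<Sum>x\<in>?Z w. deg x)" by simp
    also have "\<dots> \<le> real (expansion_const k m * (card (?Z w) + card V))"
      unfolding deg_def by (rule of_nat_mono[OF antipode_degree_sum[OF E V order_refl k no]])
    also have "\<dots> = expansion_const k m * (real (card (?Z w)) + ?n)"
      by (simp only: of_nat_mult of_nat_add)
    also have "\<dots> \<le> expansion_const k m * (?n + ?n)"
      using card_mono[OF V(1) ZV[of w]] by (intro mult_left_mono) auto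
    finally show "(\<Sum>x\<in>{x \<in> V. w \<in> ?Z x}. real (deg x)) \<le> 2 * real (expansion_const k m) * ?n" by simp
  qed
  also have "\<dots> = 2 * real (expansion_const k m) * ?n ^ 2" by (simp add: power2_eq_square)
  finally show ?thesis .
qed

lemma few_light_cycles:
  fixes E :: "('a \<times> 'a) set"
  assumes fin: "finite (cycles r E)" and r: "2 \<le> r"
    and few: "real (card {p \<in> cycles r E. P (p ! 0) (p ! 1)}) \<le> b"
  shows "real (card {p \<in> cycles r E. \<exists>i<r. P (p ! i) (p ! (Suc i mod r))}) \<le> real r * b"
proof -
  let ?A = "\<lambda>i. {p \<in> cycles r E. P (p ! i) (p ! (Suc i mod r))}"
  have "{p \<in> cycles r E. \<exists>i<r. P (p ! i) (p ! (Suc i mod r))} = (\<Union>i<r. ?A i)" by auto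
  then have "card {p \<in> cycles r E. \<exists>i<r. P (p ! i) (p ! (Suc i mod r))} \<le> (\<Sum>i<r. card (?A i))"
    using card_UN_le[of "{..<r}" ?A] by simp
  also have "\<dots> \<le> (\<Sum>i<r. card {p \<in> cycles r E. P (p ! 0) (p ! 1)})"
    by (intro sum_mono card_cycles_rotate fin r) simp
  also have "\<dots> = r * card {p \<in> cycles r E. P (p ! 0) (p ! 1)}" by simp
  finally have "real (card {p \<in> cycles r E. \<exists>i<r. P (p ! i) (p ! (Suc i mod r))})
    \<le> real r * real (card {p \<in> cycles r E. P (p ! 0) (p ! 1)})"
    unfolding of_nat_mult[symmetric] by (rule of_nat_mono)
  also have "\<dots> \<le> real r * b" using few by (rule mult_left_mono) simp
  finally show ?thesis .
qed

text \<open>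
  If only few cycles pass through \<open>x\<close>, then \<open>x\<close> lies on few arcs that carry many cycles. Both
  directions of an arc are counted, so that the arcs that carry many cycles form a symmetric
  relation.
\<close>

lemma heavy_arcs_at_vertex:
  assumes V: "finite V" and fin: "finite (cycles r E)" and r: "2 \<le> r" and \<tau>: "0 < \<tau>"
    and c: "real (card {p \<in> cycles r E. p ! 0 = x}) \<le> M"
  defines "t \<equiv> \<lambda>x y. real (card {p \<in> cycles r E. p ! 0 = x \<and> p ! 1 = y})"
  shows "real (card {y \<in> V. \<tau> \<le> t x y \<or> \<tau> \<le> t y x}) \<le> 2 * M / \<tau>"
proof -
  let ?L = "cycles r E"
  have out: "\<tau> * real (card {y \<in> V. \<tau> \<le> t x y}) \<le> M"
  proof -
    have "\<tau> * real (card {y \<in> V. \<tau> \<le> t x y}) = (\<Sum>y\<in>{y \<in> V. \<tau> \<le> t x y}. \<tau>)" by simp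
    also have "\<dots> \<le> (\<Sum>y\<in>{y \<in> V. \<tau> \<le> t x y}. t x y)" by (rule sum_mono) simp
    also have "\<dots> = real (\<Sum>y\<in>{y \<in> V. \<tau> \<le> t x y}. card {p \<in> {p \<in> ?L. p ! 0 = x}. p ! 1 = y})"
      by (simp add: t_def conj_assoc)
    also have "\<dots> \<le> real (card {p \<in> ?L. p ! 0 = x})"
      using V fin by (subst sum_card_fibres) (auto intro!: card_mono)
    finally show ?thesis using c by simp
  qed
  have into: "\<tau> * real (card {y \<in> V. \<tau> \<le> t y x}) \<le> M"
  proof -
    have "\<tau> * real (card {y \<in> V. \<tau> \<le> t y x}) = (\<Sum>y\<in>{y \<in> V. \<tau> \<le> t y x}. \<tau>)" by simp
    also have "\<dots> \<le> (\<Sum>y\<in>{y \<in> V. \<tau> \<le> t y x}. t y x)" by (rule sum_mono) simp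
    also have "\<dots> = real (\<Sum>y\<in>{y \<in> V. \<tau> \<le> t y x}. card {p \<in> {p \<in> ?L. p ! 1 = x}. p ! 0 = y})"
      by (simp add: t_def conj_assoc conj_commute[of "_ ! 0 = _"])
    also have "\<dots> \<le> real (card {p \<in> ?L. p ! 1 = x})"
      using V fin by (subst sum_card_fibres) (auto intro!: card_mono)
    also have "card {p \<in> ?L. p ! 1 = x} \<le> card {p \<in> ?L. p ! 0 = x}"
      using card_cycles_rotate[OF fin, of 1 "\<lambda>a _. a = x"] r by simp
    finally show ?thesis using c by simp
  qed
  have "{y \<in> V. \<tau> \<le> t x y \<or> \<tau> \<le> t y x} = {y \<in> V. \<tau> \<le> t x y} \<union> {y \<in> V. \<tau> \<le> t y x}" by auto
  then have "card {y \<in> V. \<tau> \<le> t x y \<or> \<tau> \<le> t y x}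
    \<le> card {y \<in> V. \<tau> \<le> t x y} + card {y \<in> V. \<tau> \<le> t y x}"
    by (simp only: card_Un_le)
  then have "real (card {y \<in> V. \<tau> \<le> t x y \<or> \<tau> \<le> t y x})
    \<le> real (card {y \<in> V. \<tau> \<le> t x y}) + real (card {y \<in> V. \<tau> \<le> t y x})"
    unfolding of_nat_add[symmetric] by (rule of_nat_mono)
  also have "\<dots> \<le> M / \<tau> + M / \<tau>"
    using out into \<tau> by (intro add_mono) (simp_all add: pos_le_divide_eq mult.commute)
  finally show ?thesis by simp
qed

text \<open>
  Let \<open>n\<close> be the number of vertices, \<open>N\<close> the number of cycles of length \<open>r = 2 k + 1\<close>, and ignore
  constants. A vertex lies on at most \<open>n\<close> cycles. All but a quarter of the cycles visit only heavy
  vertices, those on at least \<open>N / n\<close> cycles. Heavy vertices have at least \<open>N / n\<close> antipodes, so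
  there are at most \<open>n ^ 3 / N\<close> arcs that start in them. All but another quarter of
  the cycles use only such arcs that carry at least \<open>N ^ 2 / n ^ 3\<close> cycles. The graph \<open>F\<close> of
  all arcs that carry so many cycles in one of their directions has maximum degree at most
  \<open>n ^ 4 / N ^ 2\<close>, because a vertex lies on at most \<open>n\<close> cycles. It still contains half of the
  cycles, but in \<open>F\<close> a vertex has at most \<open>(n ^ 4 / N ^ 2) ^ k\<close> antipodes and lies on no more
  cycles than that. Hence \<open>N \<le> n * (n ^ 4 / N ^ 2) ^ k\<close>.
\<close>

lemma odd_cycle_bound:
  fixes E :: "('a \<times> 'a) set"
  assumes E: "sym E" and V: "finite V" "E \<subseteq> V \<times> V" and k: "1 \<le> k"
    and short: "\<And>p. simple_cycle E p \<Longrightarrow> 3 \<le> length p \<Longrightarrow> 2 * k < length p"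
    and no: "\<And>p. simple_cycle E p \<Longrightarrow> length p \<noteq> 2 * k + 2 * m + 1"
  defines "C \<equiv> real (expansion_const k m)" and "r \<equiv> 2 * k + 1"
  shows "real (card (cycles r E)) ^ (2 * k + 1)
    \<le> 4 * C * (256 * real r ^ 2 * C ^ 3) ^ k * real (card V) ^ (4 * k + 1)"
proof (cases "card (cycles r E) = 0")
  case False
  let ?L = "cycles r E"
  define N where "N = real (card ?L)"
  define n where "n = real (card V)"
  define c where "c v = real (card {p \<in> ?L. p ! 0 = v})" for v
  define t where "t x y = real (card {p \<in> ?L. p ! 0 = x \<and> p ! 1 = y})" for x y
  have r: "2 \<le> r" "0 < r" using k by (auto simp: r_def)
  have C: "1 \<le> C" using expansion_const_ge_1[of k m] by (simp add: C_def)
  have fin: "finite ?L" using V by (rule finite_cycles)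
  have N: "0 < N" using False by (simp add: N_def)
  have in_V: "p ! i \<in> V" "(p ! i, p ! (Suc i mod r)) \<in> E" if "p \<in> ?L" "i < r" for p i
    using that V by (auto simp: cycles_def simple_cycle_conv_nth)
  obtain p where "p \<in> ?L" using False by (metis card.empty ex_in_conv)
  then have "V \<noteq> {}" using in_V(1) r(2) by blast
  then have n: "1 \<le> n" using V(1) by (simp add: n_def Suc_leI card_gt_0_iff)

  have c_bound: "c v \<le> 2 * C * real (card (antipodes k E v))" for v
  proof -
    have "real (card {p \<in> ?L. p ! 0 = v}) \<le> real (2 * expansion_const k m * card (antipodes k E v))"
      unfolding r_def by (rule of_nat_mono[OF cycles_through_vertex[OF E V k short no]])
    then show ?thesis unfolding c_def C_def by (simp only: of_nat_mult of_nat_numeral)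
  qed
  have c_bound': "c v \<le> 2 * C * n" for v
  proof -
    have "real (card (antipodes k E v)) \<le> n"
      unfolding n_def using antipodes_subset[OF V(2)] V(1) by (intro of_nat_mono card_mono)
    then have "2 * C * real (card (antipodes k E v)) \<le> 2 * C * n" using C by (intro mult_left_mono) auto
    then show ?thesis using c_bound[of v] by linarith
  qed

  \<comment> \<open>The thresholds are such that each of the \<open>r\<close> positions on a cycle is light for at most
    \<open>N / (4 r)\<close> cycles.\<close>
  define U where "U = {v \<in> V. N / (4 * r * n) \<le> c v}"
  define B where "B = 16 * r * C ^ 2 * n ^ 3 / N"
  define \<tau> where "\<tau> = N / (4 * r * B)"
  have B: "0 < B" using r C n N by (simp add: B_def)
  have \<tau>: "0 < \<tau>" using r B N by (simp add: \<tau>_def)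
  have arcs: "real (card {e \<in> E. fst e \<in> U}) \<le> B"
  proof -
    have "N / (8 * r * n * C) \<le> real (card (antipodes k E v))" if "v \<in> U" for v
    proof -
      have "N / (4 * r * n) \<le> 2 * C * real (card (antipodes k E v))"
        using that c_bound[of v] by (auto simp: U_def)
      then show ?thesis using r n C by (simp add: field_simps)
    qed
    then have "N / (8 * r * n * C) * real (card {e \<in> E. fst e \<in> U}) \<le> 2 * C * n ^ 2"
      unfolding C_def n_def by (intro heavy_degree_sum[OF E V k no]) (auto simp: U_def)
    then show ?thesis using r n C N by (simp add: B_def field_simps power2_eq_square power3_eq_cube)
  qed

  define L1 where "L1 = {p \<in> ?L. \<exists>i<r. p ! i \<notin> U}"
  define L2 where "L2 = {p \<in> ?L. \<exists>i<r. p ! i \<in> U \<and> t (p ! i) (p ! (Suc i mod r)) < \<tau>}"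
  have L1: "real (card L1) \<le> N / 4"
  proof -
    have "{p \<in> ?L. p ! 0 \<notin> U} = {p \<in> ?L. p ! 0 \<in> V - U}" using in_V(1) r by blast
    then have "real (card {p \<in> ?L. p ! 0 \<notin> U}) = (\<Sum>v\<in>V - U. c v)"
      using sum_card_fibres[OF fin, of "V - U" "\<lambda>p. p ! 0"] V(1) by (simp add: c_def flip: of_nat_sum)
    also have "\<dots> \<le> (\<Sum>v\<in>V - U. N / (4 * r * n))" by (rule sum_mono) (auto simp: U_def)
    also have "\<dots> = real (card (V - U)) * (N / (4 * r * n))" by simp
    also have "\<dots> \<le> n * (N / (4 * r * n))"
      using V(1) N n by (intro mult_right_mono) (auto simp: n_def intro: card_mono)
    also have "\<dots> = N / (4 * r)" using n by simp
    finally have "real (card L1) \<le> real r * (N / (4 * r))"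
      unfolding L1_def by (rule few_light_cycles[OF fin r(1), where P = "\<lambda>x _. x \<notin> U"])
    then show ?thesis using r by simp
  qed
  have L2: "real (card L2) \<le> N / 4"
  proof -
    let ?A = "{e \<in> E. fst e \<in> U \<and> t (fst e) (snd e) < \<tau>}"
    have finE: "finite E" using V finite_subset by blast
    have "{p \<in> ?L. p ! 0 \<in> U \<and> t (p ! 0) (p ! 1) < \<tau>} = {p \<in> ?L. (p ! 0, p ! 1) \<in> ?A}"
      using in_V(2)[of _ 0] r by auto
    then have "real (card {p \<in> ?L. p ! 0 \<in> U \<and> t (p ! 0) (p ! 1) < \<tau>})
        = real (\<Sum>e\<in>?A. card {p \<in> ?L. (p ! 0, p ! 1) = e})"
      using sum_card_fibres[OF fin, of ?A "\<lambda>p. (p ! 0, p ! 1)"] finE by simp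
    also have "\<dots> = (\<Sum>e\<in>?A. t (fst e) (snd e))"
      by (simp add: t_def prod_eq_iff)
    also have "\<dots> \<le> (\<Sum>e\<in>?A. \<tau>)" by (rule sum_mono) auto
    also have "\<dots> = real (card ?A) * \<tau>" by simp
    also have "\<dots> \<le> B * \<tau>"
    proof (rule mult_right_mono)
      have "card ?A \<le> card {e \<in> E. fst e \<in> U}" using finE by (intro card_mono) auto
      then show "real (card ?A) \<le> B" using arcs by linarith
    qed (use \<tau> in simp)
    also have "\<dots> = N / (4 * r)" using B by (simp add: \<tau>_def)
    finally have "real (card L2) \<le> real r * (N / (4 * r))"
      unfolding L2_def by (rule few_light_cycles[OF fin r(1), where P = "\<lambda>x y. x \<in> U \<and> t x y < \<tau>"])
    then show ?thesis using r by simp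
  qed

  define F where "F = {e \<in> E. \<tau> \<le> t (fst e) (snd e) \<or> \<tau> \<le> t (snd e) (fst e)}"
  have F: "sym F" "F \<subseteq> E" using E by (auto simp: F_def sym_def)
  have FV: "F \<subseteq> V \<times> V" using F V by blast
  have finF: "finite F" using FV V(1) by (meson finite_SigmaI finite_subset)
  have "?L - L1 - L2 \<subseteq> cycles r F"
  proof
    fix p assume p: "p \<in> ?L - L1 - L2"
    then have "(p ! i, p ! (Suc i mod r)) \<in> F" if "i < r" for i
      using in_V(2)[of p i] that by (auto simp: F_def L1_def L2_def)
    then show "p \<in> cycles r F" using p by (auto simp: cycles_def simple_cycle_conv_nth)
  qed
  then have "?L \<subseteq> L1 \<union> L2 \<union> cycles r F" by blast
  then have "card ?L \<le> card (L1 \<union> L2 \<union> cycles r F)"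
    using fin finite_cycles[OF V(1) FV] by (intro card_mono) (auto simp: L1_def L2_def)
  also have "\<dots> \<le> card L1 + card L2 + card (cycles r F)"
    by (metis (no_types, lifting) add_le_mono1 card_Un_le le_trans)
  finally have many: "N / 2 \<le> real (card (cycles r F))" using L1 L2 by (simp add: N_def)

  define D where "D = 4 * C * n / \<tau>"
  have deg: "real (card {y. (x, y) \<in> F}) \<le> D" for x
  proof -
    have "card {y. (x, y) \<in> F} \<le> card {y \<in> V. \<tau> \<le> t x y \<or> \<tau> \<le> t y x}"
      using V FV by (intro card_mono) (auto simp: F_def)
    moreover have "real (card {y \<in> V. \<tau> \<le> t x y \<or> \<tau> \<le> t y x}) \<le> 2 * (2 * C * n) / \<tau>"
      unfolding t_def using c_bound'[of x] unfolding c_def by (rule heavy_arcs_at_vertex[OF V(1) fin r(1) \<tau>])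
    ultimately show ?thesis unfolding D_def by simp
  qed
  have "real (card (cycles r F)) = (\<Sum>w\<in>V. real (card {p \<in> cycles r F. p ! 0 = w}))"
    using cycles_by_start[OF V(1) FV r(2)] by simp
  also have "\<dots> \<le> (\<Sum>w\<in>V. 2 * C * D ^ k)"
  proof (rule sum_mono)
    fix w
    have "card {p \<in> cycles r F. p ! 0 = w} \<le> 2 * expansion_const k m * card (antipodes k F w)"
      unfolding r_def using short no simple_cycle_mono[OF _ F(2)]
      by (intro cycles_through_vertex[OF F(1) V(1) FV k]) blast+
    then have "real (card {p \<in> cycles r F. p ! 0 = w})
        \<le> real (2 * expansion_const k m * card (antipodes k F w))" by (rule of_nat_mono)
    also have "\<dots> = 2 * C * real (card (antipodes k F w))"
      unfolding C_def by (simp only: of_nat_mult of_nat_numeral)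
    also have "\<dots> \<le> 2 * C * D ^ k"
      using C finF by (intro mult_left_mono antipodes_bounded_degree[OF deg _ k]) auto
    finally show "real (card {p \<in> cycles r F. p ! 0 = w}) \<le> 2 * C * D ^ k" .
  qed
  also have "\<dots> = 2 * C * n * D ^ k" by (simp add: n_def)
  finally have "N \<le> 4 * C * n * D ^ k" using many by simp
  moreover have "D = 256 * real r ^ 2 * C ^ 3 * n ^ 4 / N ^ 2"
    using r N n C by (simp add: D_def \<tau>_def B_def field_simps eval_nat_numeral)
  then have "D ^ k = (256 * real r ^ 2 * C ^ 3) ^ k * n ^ (4 * k) / N ^ (2 * k)"
    by (simp only: power_divide power_mult_distrib power_mult)
  ultimately have "N \<le> 4 * C * n * ((256 * real r ^ 2 * C ^ 3) ^ k * n ^ (4 * k)) / N ^ (2 * k)"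
    by simp
  then have "N * N ^ (2 * k) \<le> 4 * C * n * ((256 * real r ^ 2 * C ^ 3) ^ k * n ^ (4 * k))"
    using N by (simp only: pos_le_divide_eq zero_less_power)
  then show ?thesis by (simp only: N_def n_def power_add power_one_right mult_ac)
next
  case True
  have "0 \<le> C" unfolding C_def by (rule of_nat_0_le_iff)
  then have "0 \<le> 4 * C * (256 * real r ^ 2 * C ^ 3) ^ k * real (card V) ^ (4 * k + 1)"
    by (intro mult_nonneg_nonneg zero_le_power) simp_all
  moreover have "real (card (cycles r E)) ^ (2 * k + 1) = 0" unfolding True by simp
  ultimately show ?thesis by linarith
qed

section \<open>Copies of a cycle in a graph\<close>

text \<open>
  Listing the images of \<open>0, \<dots>, r - 1\<close> under an isomorphism gives a cycle from which the copy can
  be recovered; hence there are at most as many copies as cycle lists.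
\<close>

lemma copy_is_cycle:
  assumes "K \<in> copies (cycle_graph r) G" and r: "0 < r"
  shows "\<exists>p\<in>cycles r (parcs G). K = relabel ((!) p) (cycle_graph r)"
proof -
  let ?H = "with_proj (cycle_graph r)"
  from assms(1) obtain h where K: "parcs K \<subseteq> parcs G"
    and h: "pre_digraph.digraph_isomorphism ?H h" "with_proj K = app_iso h ?H"
    by (auto simp: copies_def subgraph_def digraph_iso_def)
  define f where "f = iso_verts h"
  have verts: "pverts K = f ` {0..<r}"
    using arg_cong[OF h(2), of verts] by (simp add: app_iso_def f_def cycle_graph_def)
  have arcs: "parcs K = iso_arcs h ` parcs (cycle_graph r)"
    and "iso_tail h = fst" "iso_head h = snd"
    using arg_cong[OF h(2), of arcs] arg_cong[OF h(2), of tail] arg_cong[OF h(2), of head]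
    by (simp_all add: app_iso_def)
  then have ends: "iso_arcs h a = (f (fst a), f (snd a))" if "a \<in> parcs (cycle_graph r)" for a
    using h(1) that unfolding pre_digraph.digraph_isomorphism_def f_def
    by (intro prod_eqI) auto
  have inj: "inj_on f {0..<r}"
    using h(1) unfolding pre_digraph.digraph_isomorphism_def by (simp add: f_def cycle_graph_def)
  define p where "p = map f [0..<r]"
  have p: "p ! i = f i" if "i < r" for i using that by (simp add: p_def)
  have "relabel ((!) p) (cycle_graph r) = K"
  proof (rule pair_pre_digraph.equality)
    show "pverts (relabel ((!) p) (cycle_graph r)) = pverts K"
      by (simp add: relabel_def verts cycle_graph_def p)
    show "parcs (relabel ((!) p) (cycle_graph r)) = parcs K"
      unfolding arcs relabel_def
      by (auto simp: p ends cycle_graph_def intro!: image_cong)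
  qed simp
  moreover have "(f i, f (Suc i mod r)) \<in> parcs K" if "i < r" for i
  proof -
    have "(i, Suc i mod r) \<in> parcs (cycle_graph r)" using that by (auto simp: cycle_graph_def)
    from imageI[OF this, of "iso_arcs h"] ends[OF this] show ?thesis by (simp add: arcs)
  qed
  ultimately show ?thesis
    using K inj r by (intro bexI[of _ p]) (auto simp: cycles_def simple_cycle_conv_nth p distinct_map p_def)
qed

lemma cycle_gives_copy:
  assumes "pair_graph G" "p \<in> cycles r (parcs G)" "3 \<le> r"
  shows "relabel ((!) p) (cycle_graph r) \<in> copies (cycle_graph r) G"
proof -
  interpret pair_graph G by fact
  have p: "length p = r" "distinct p" "\<And>i. i < r \<Longrightarrow> (p ! i, p ! (Suc i mod r)) \<in> parcs G"
    using assms(2) by (auto simp: cycles_def simple_cycle_conv_nth)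
  have inj: "inj_on ((!) p) (pverts (cycle_graph r))"
    using p by (auto simp: cycle_graph_def inj_on_nth)
  have H: "pair_graph (cycle_graph r)" by (rule pair_graph_cycle_graph[OF assms(3)])
  have "p ! i \<in> pverts G" if "i < r" for i using p(3)[OF that] in_arcsD1 by blast
  then have "pverts (relabel ((!) p) (cycle_graph r)) \<subseteq> pverts G"
    by (auto simp: relabel_def cycle_graph_def)
  moreover have "parcs (relabel ((!) p) (cycle_graph r)) \<subseteq> parcs G"
    using p(3) arcs_symmetric by (auto simp: relabel_def cycle_graph_def)
  ultimately show ?thesis
    using pair_graph_relabel[OF H inj] digraph_iso_relabel[OF H inj] assms(1)
    by (simp add: copies_def subgraph_with_proj_iff)
qed

lemma num_copies_le_cycles:
  assumes "pair_graph G" "0 < r"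
  shows "num_copies (cycle_graph r) G \<le> card (cycles r (parcs G))"
proof -
  interpret pair_graph G by fact
  have "finite (cycles r (parcs G))"
    by (rule finite_cycles[OF pair_finite_verts]) (auto dest: in_arcsD1 in_arcsD2)
  moreover have "copies (cycle_graph r) G \<subseteq> (\<lambda>p. relabel ((!) p) (cycle_graph r)) ` cycles r (parcs G)"
    using copy_is_cycle[OF _ assms(2)] by blast
  ultimately show ?thesis unfolding num_copies_def by (rule surj_card_le)
qed

lemma family_free_no_cycle:
  assumes "pair_graph G" "family_free \<F> G" "cycle_graph r \<in> \<F>" "3 \<le> r" "simple_cycle (parcs G) p"
  shows "length p \<noteq> r"
  using cycle_gives_copy[OF assms(1) _ assms(4), of p] assms(2,3,5)
  by (auto simp: family_free_def cycles_def)

text \<open>The edgeless graph shows that the maximum that defines \<^const>\<open>gen_turan\<close> ranges over a nonempty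
  set.\<close>

lemma exists_family_free:
  assumes "\<And>H. H \<in> \<F> \<Longrightarrow> \<exists>r>0. H = cycle_graph r"
  shows "\<exists>G :: nat pair_pre_digraph. pair_graph G \<and> card (pverts G) = n \<and> family_free \<F> G"
proof (intro exI conjI)
  let ?G = "\<lparr> pverts = {0..<n}, parcs = {} \<rparr> :: nat pair_pre_digraph"
  show "pair_graph ?G" by unfold_locales (auto simp: symmetric_def sym_def)
  show "card (pverts ?G) = n" by simp
  have "cycles r (parcs ?G) = {}" for r by (auto simp: cycles_def simple_cycle_def)
  then show "family_free \<F> ?G"
    unfolding family_free_def using assms copy_is_cycle by (metis all_not_in_conv)
qed

lemma gen_turan_attained:
  fixes G :: "nat pair_pre_digraph"
  assumes "pair_graph G" "card (pverts G) = n" "family_free \<F> G"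
  shows "\<exists>G :: nat pair_pre_digraph. pair_graph G \<and> card (pverts G) = n \<and> family_free \<F> G
    \<and> gen_turan n H \<F> = num_copies H G"
proof -
  let ?A = "{num_copies H G |G :: nat pair_pre_digraph. pair_graph G \<and> card (pverts G) = n \<and> family_free \<F> G}"
  have "gen_turan n H \<F> \<in> ?A"
    unfolding gen_turan_def using assms by (intro Max_in finite_turan_values) blast
  then show ?thesis by blast
qed


section \<open>The bound on the Turan number\<close>

lemma root_bound:
  assumes "0 \<le> N" "0 < K" "1 \<le> n" and le: "N ^ (2 * k + 1) \<le> K * n ^ (4 * k + 1)"
  shows "N \<le> K powr (1 / (2 * k + 1)) * n powr (2 - 1 / (2 * k + 1))"
proof (cases "N = 0")
  case False
  define s where "s = real (2 * k + 1)"
  have s: "0 < s" by (simp add: s_def)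
  have "N powr s \<le> K * n powr real (4 * k + 1)"
    using le assms False unfolding s_def by (subst (1 2) powr_realpow) auto
  then have "(N powr s) powr (1 / s) \<le> (K * n powr real (4 * k + 1)) powr (1 / s)"
    using s by (intro powr_mono2) auto
  also have "\<dots> = K powr (1 / s) * n powr (real (4 * k + 1) * (1 / s))"
    using assms by (simp add: powr_mult powr_powr)
  also have "real (4 * k + 1) * (1 / s) = 2 - 1 / s" using s by (simp add: field_simps s_def)
  finally show ?thesis using assms False s by (simp add: powr_powr s_def)
qed simp

text \<open>For \<open>k \<ge> 2\<close> already \<open>k (k + 1) \<ge> 2 k + 1\<close>.\<close>

lemma exponent_le:
  assumes "2 \<le> k" "k < l"
  shows "2 - 1 / (2 * real k + 1) \<le> 2 - 1 / (real k * (real k + 1) * (real l - real k))"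
proof -
  have "2 * k + 1 \<le> k * (k + 1)"
    using mult_le_mono1[OF assms(1), of k] assms(1) unfolding distrib_left by linarith
  then have "real (2 * k + 1) \<le> real (k * (k + 1))" by (rule of_nat_mono)
  then have "2 * real k + 1 \<le> real k * (real k + 1) * 1" by (simp add: algebra_simps)
  also have "\<dots> \<le> real k * (real k + 1) * (real l - real k)"
    using assms(2) by (intro mult_left_mono) auto
  finally show ?thesis by (simp add: frac_le)
qed

theorem theorem1p2:
  fixes k l :: nat
  assumes "2 \<le> k" and "k < l"
  shows "\<exists>K>0. \<forall>n\<ge>1.
    real (gen_turan n (cycle_graph (2 * k + 1)) (cycles_upto (2 * k) \<union> {cycle_graph (2 * l + 1)}))
      \<le> K * real n powr (2 - 1 / (real k * (real k + 1) * (real l - real k)))"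
proof -
  let ?F = "cycles_upto (2 * k) \<union> {cycle_graph (2 * l + 1)}"
  define C where "C = real (expansion_const k (l - k))"
  define K where "K = 4 * C * (256 * real (2 * k + 1) ^ 2 * C ^ 3) ^ k"
  have "0 < C" using expansion_const_ge_1[of k "l - k"] by (simp add: C_def)
  then have K: "0 < K" by (simp add: K_def)
  have "real (gen_turan n (cycle_graph (2 * k + 1)) ?F)
      \<le> K powr (1 / (2 * k + 1)) * real n powr (2 - 1 / (real k * (real k + 1) * (real l - real k)))"
    if "1 \<le> n" for n
  proof -
    have "\<exists>r>0. H = cycle_graph r" if "H \<in> ?F" for H
    proof (cases "H = cycle_graph (2 * l + 1)")
      case True
      then show ?thesis by (intro exI[of _ "2 * l + 1"]) simp
    next
      case False
      then obtain i where "i \<in> {3..2 * k}" "H = cycle_graph i"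
        using \<open>H \<in> ?F\<close> by (auto simp: cycles_upto_def)
      then show ?thesis by (intro exI[of _ i]) simp
    qed
    from exists_family_free[OF this, of ?F n] obtain G0 :: "nat pair_pre_digraph"
      where "pair_graph G0" "card (pverts G0) = n" "family_free ?F G0" by blast
    from gen_turan_attained[OF this, of "cycle_graph (2 * k + 1)"] obtain G :: "nat pair_pre_digraph"
      where G: "pair_graph G" "card (pverts G) = n" "family_free ?F G"
        and max: "gen_turan n (cycle_graph (2 * k + 1)) ?F = num_copies (cycle_graph (2 * k + 1)) G"
      by blast
    interpret pair_graph G by fact
    have sym: "sym (parcs G)" using arcs_symmetric by (auto simp: sym_def)
    have sub: "parcs G \<subseteq> pverts G \<times> pverts G" by (auto dest: in_arcsD1 in_arcsD2)
    have short: "2 * k < length p" if "simple_cycle (parcs G) p" "3 \<le> length p" for p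
      using family_free_no_cycle[OF G(1,3) _ that(2,1)] that(2) unfolding cycles_upto_def
      by (metis UnI1 atLeastAtMost_iff imageI linorder_not_less)
    have no: "length p \<noteq> 2 * k + 2 * (l - k) + 1" if "simple_cycle (parcs G) p" for p
      using family_free_no_cycle[OF G(1,3) _ _ that, of "2 * l + 1"] assms by simp
    define N where "N = real (card (cycles (2 * k + 1) (parcs G)))"
    have "N ^ (2 * k + 1) \<le> K * real n ^ (4 * k + 1)"
      using odd_cycle_bound[OF sym pair_finite_verts sub _ short no] assms(1)
      unfolding N_def K_def C_def G(2) by simp
    then have N: "N \<le> K powr (1 / (2 * k + 1)) * real n powr (2 - 1 / (2 * k + 1))"
      using K \<open>1 \<le> n\<close> by (intro root_bound) (auto simp: N_def)
    have "real (num_copies (cycle_graph (2 * k + 1)) G) \<le> N"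
      unfolding N_def by (rule of_nat_mono[OF num_copies_le_cycles[OF G(1)]]) simp
    also note N
    also have "K powr (1 / (2 * k + 1)) * real n powr (2 - 1 / (2 * k + 1))
      \<le> K powr (1 / (2 * k + 1)) * real n powr (2 - 1 / (real k * (real k + 1) * (real l - real k)))"
      using exponent_le[OF assms] \<open>1 \<le> n\<close> by (intro mult_left_mono powr_mono) (auto simp: add.commute)
    finally show ?thesis unfolding max .
  qed
  moreover have "0 < K powr (1 / (2 * k + 1))" using K by simp
  ultimately show ?thesis by blast
qed

end
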